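(* The set of positive integers $A$ such that either $A=1$ or the pair $A,2$ is not order-dominant has asymptotic density $0$.
   Context: For a prime $p$ and a rational number $\alpha$ that is a $p$-adic unit, $\mathrm{ord}_p(\alpha)$ denotes the multiplicative order of $\alpha \bmod p$ in $\mathbb{F}_p^{\times}$. For $\alpha,\beta\in\mathbb{Q}^{\times}\setminus\{\pm1\}$, the ordered pair $\alpha,\beta$ is called order-dominant if $\mathrm{ord}_p(\alpha)>\mathrm{ord}_p(\beta)$ for infinitely many primes $p$. *)

theory Defs
  imports Complex_Main "HOL-Number_Theory.Number_Theory"
begin

definition padic_unit :: "nat \<Rightarrow> rat \<Rightarrow> bool" where
  "padic_unit p \<alpha> \<longleftrightarrow>
     \<not> int p dvd fst (quotient_of \<alpha>) \<and> \<not> int p dvd snd (quotient_of \<alpha>)"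

text \<open>
  The least non-negative representative of the reduction modulo p of a rational whose reduced
  denominator is prime to p.
\<close>

definition rat_mod :: "rat \<Rightarrow> nat \<Rightarrow> nat" where
  "rat_mod \<alpha> p =
     nat ((fst (quotient_of \<alpha>) * modular_inverse (int p) (snd (quotient_of \<alpha>))) mod int p)"

text \<open>
  The multiplicative order of \<open>\<alpha>\<close> mod p in the unit group of the field with p elements. It is
  meaningful only for p prime and \<open>\<alpha>\<close> a p-adic unit.
\<close>

definition ord_mod_prime :: "nat \<Rightarrow> rat \<Rightarrow> nat" where
  "ord_mod_prime p \<alpha> = ord p (rat_mod \<alpha> p)"

text \<open>
  The requirement that both numbers be p-adic units, implicit in the use of the two orders,
  excludes only finitely many primes.
\<close>

definition order_dominant :: "rat \<Rightarrow> rat \<Rightarrow> bool" where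
  "order_dominant \<alpha> \<beta> \<longleftrightarrow> \<alpha> \<notin> {0, 1, -1} \<and> \<beta> \<notin> {0, 1, -1} \<and>
     infinite {p. prime p \<and> padic_unit p \<alpha> \<and> padic_unit p \<beta> \<and>
       ord_mod_prime p \<alpha> > ord_mod_prime p \<beta>}"

definition has_asymptotic_density :: "nat set \<Rightarrow> real \<Rightarrow> bool" where
  "has_asymptotic_density S d \<longleftrightarrow>
     (\<lambda>N. real (card (S \<inter> {1..N})) / real N) \<longlonglongrightarrow> d"

end

theory Submission
  imports Defs
begin

text \<open>
  Let \<open>F k = 2 ^ 2 ^ k + 1\<close>. A prime factor \<open>p\<close> of \<open>F k\<close> has \<open>ord p 2 = 2 ^ (k + 1)\<close> and, as 2 is a
  square mod \<open>p\<close>, \<open>2 ^ (k + 2)\<close> divides \<open>p - 1\<close>. If \<open>A\<close> is a nonresidue mod \<open>p\<close>, then \<open>2 ^ (k + 2)\<close>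
  divides \<open>ord p A\<close>, which hence exceeds \<open>ord p 2\<close>. So \<open>A\<close> dominates 2 as soon as the Jacobi symbol
  of \<open>A\<close> over \<open>F k\<close> is \<open>-1\<close> for infinitely many \<open>k\<close>. By reciprocity this symbol is periodic
  in \<open>k\<close> from \<open>k0\<close> on if no prime \<open>q \<equiv> 1 (mod 2 ^ (k0 + 1))\<close> divides \<open>A\<close>, and then a single
  value \<open>-1\<close> suffices.

  For fixed \<open>J\<close> and \<open>2 ^ 2 ^ (k + J) \<le> N < 2 ^ 2 ^ (k + J + 1)\<close>, an exceptional \<open>A \<le> N\<close> thus either has
  symbol 1 over \<open>F k, \<dots>, F (k + J - 1)\<close>, or has a prime factor \<open>q \<equiv> 1 (mod 2 ^ (k + 1))\<close>.
  Since the \<open>F j\<close> are coprime with product at most \<open>N\<close> and 3 has symbol \<open>-1\<close> over each of them, there are at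
  most \<open>2 * N / 2 ^ J\<close> of the first kind. The sum of \<open>1 / q\<close> over all integers \<open>q \<le> N\<close> congruent
  to 1 is about \<open>2 ^ J\<close>; keeping only those \<open>q\<close> that are coprime to a fixed odd \<open>W\<close> with at
  most \<open>W / 4 ^ J\<close> coprime residues makes it as small as \<open>2 / 2 ^ J\<close>.
\<close>

section \<open>Jacobi symbols\<close>

lemma Legendre_cong: "[a = b] (mod p) \<Longrightarrow> Legendre a p = Legendre b p"
  by (simp add: Legendre_def QuadRes_def cong_def)

lemma Legendre_cases: "Legendre a p = -1 \<or> Legendre a p = 0 \<or> Legendre a p = 1"
  unfolding Legendre_def by auto

text \<open>Both sides lie in {-1, 0, 1}, hence differ by at most 2, which is less than
  \<open>p\<close>. The congruence supplied by Euler's criterion therefore forces equality.\<close>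

lemma Legendre_eqI:
  assumes "prime p" "2 < p" and x: "x = -1 \<or> x = 0 \<or> x = 1"
    and "[x = a ^ ((p - 1) div 2)] (mod int p)"
  shows "Legendre a (int p) = x"
proof -
  have "[Legendre a (int p) = x] (mod int p)"
    using euler_criterion[OF assms(1,2), of a] assms(4) cong_sym cong_trans by blast
  then have d: "int p dvd Legendre a (int p) - x"
    by (simp add: cong_iff_dvd_diff)
  have "\<bar>Legendre a (int p) - x\<bar> < int p"
    using Legendre_cases[of a "int p"] x assms(2) by auto
  then have "Legendre a (int p) - x = 0"
    using d zdvd_not_zless[of "\<bar>Legendre a (int p) - x\<bar>" "int p"] by auto
  then show ?thesis
    by simp
qed

lemma Legendre_mult:
  assumes "prime p" "2 < p"
  shows "Legendre (a * b) (int p) = Legendre a (int p) * Legendre b (int p)"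
proof (rule Legendre_eqI[OF assms])
  show "Legendre a (int p) * Legendre b (int p) = -1 \<or> Legendre a (int p) * Legendre b (int p) = 0 \<or>
        Legendre a (int p) * Legendre b (int p) = 1"
    using Legendre_cases[of a "int p"] Legendre_cases[of b "int p"] by auto
  show "[Legendre a (int p) * Legendre b (int p) = (a * b) ^ ((p - 1) div 2)] (mod int p)"
    unfolding power_mult_distrib by (intro cong_mult euler_criterion assms)
qed

lemma Legendre_one:
  assumes "prime p" "2 < p"
  shows "Legendre 1 (int p) = 1"
  by (rule Legendre_eqI[OF assms]) auto

lemma Legendre_eq_0_iff:
  assumes "prime p"
  shows "Legendre a (int p) = 0 \<longleftrightarrow> int p dvd a"
  unfolding Legendre_def by (auto simp: cong_0_iff)

definition jacobi :: "int \<Rightarrow> nat \<Rightarrow> int" where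
  "jacobi a n = (\<Prod>p\<in>#prime_factorization n. Legendre a (int p))"

lemma odd_prime_factor_gt_2:
  assumes "odd n" "p \<in># prime_factorization n"
  shows "prime p" "2 < (p::nat)"
proof -
  show "prime p"
    using assms by (auto simp: in_prime_factors_iff)
  moreover have "p \<noteq> 2"
    using assms by (auto simp: in_prime_factors_iff)
  ultimately show "2 < p"
    using prime_ge_2_nat[of p] by linarith
qed

lemma jacobi_cong:
  assumes "[a = b] (mod int n)"
  shows "jacobi a n = jacobi b n"
proof -
  have "Legendre a (int p) = Legendre b (int p)" if "p \<in># prime_factorization n" for p
    using assms that by (intro Legendre_cong) (auto simp: in_prime_factors_iff intro: cong_dvd_modulus)
  then show ?thesis
    unfolding jacobi_def by (intro arg_cong[of _ _ prod_mset] image_mset_cong) auto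
qed

lemma jacobi_mod: "jacobi (int (a mod n)) n = jacobi (int a) n"
  by (rule jacobi_cong) (simp add: cong_def zmod_int)

lemma jacobi_mult:
  assumes "odd n"
  shows "jacobi (a * b) n = jacobi a n * jacobi b n"
proof -
  have "jacobi (a * b) n = (\<Prod>p\<in>#prime_factorization n. Legendre a (int p) * Legendre b (int p))"
    unfolding jacobi_def
    by (intro arg_cong[of _ _ prod_mset] image_mset_cong)
      (use odd_prime_factor_gt_2[OF assms] in \<open>auto intro: Legendre_mult\<close>)
  then show ?thesis
    by (simp add: jacobi_def prod_mset.distrib)
qed

lemma jacobi_one:
  assumes "odd n"
  shows "jacobi 1 n = 1"
proof -
  have "jacobi 1 n = (\<Prod>p\<in>#prime_factorization n. 1)"
    unfolding jacobi_def
    by (intro arg_cong[of _ _ prod_mset] image_mset_cong)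
      (use odd_prime_factor_gt_2[OF assms] in \<open>auto intro: Legendre_one\<close>)
  then show ?thesis
    by simp
qed

lemma prod_mset_unit_cases:
  assumes "\<forall>x\<in>#M. x = -1 \<or> x = 1"
  shows "prod_mset M = -1 \<or> prod_mset M = (1::int)"
  using assms by (induction M) auto

lemma jacobi_cases_coprime:
  assumes "coprime a n"
  shows "jacobi (int a) n = -1 \<or> jacobi (int a) n = 1"
  unfolding jacobi_def
proof (rule prod_mset_unit_cases, rule ballI)
  fix x assume "x \<in># image_mset (\<lambda>p. Legendre (int a) (int p)) (prime_factorization n)"
  then obtain p where p: "prime p" "p dvd n" "x = Legendre (int a) (int p)"
    by (auto simp: in_prime_factors_iff)
  then have "\<not> p dvd a"
    using assms by (metis coprime_common_divisor not_prime_unit)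
  then show "x = -1 \<or> x = 1"
    using p Legendre_cases[of "int a" "int p"] Legendre_eq_0_iff[of p "int a"] by auto
qed

text \<open>A product of factors 0 and 1 cannot be negative, so a symbol -1 is witnessed by one
  prime factor.\<close>

lemma jacobi_eq_minus_oneE:
  assumes "jacobi a n = -1"
  obtains p where "prime p" "p dvd n" "Legendre a (int p) = -1"
proof -
  have "\<exists>p. p \<in># prime_factorization n \<and> Legendre a (int p) = -1"
  proof (rule ccontr)
    assume "\<not> ?thesis"
    then have *: "x = 0 \<or> x = 1" if "x \<in># image_mset (\<lambda>p. Legendre a (int p)) (prime_factorization n)" for x
      using that Legendre_cases[of a] by fastforce
    have "x \<ge> 0" if "x \<in># image_mset (\<lambda>p. Legendre a (int p)) (prime_factorization n)" for x
      using *[OF that] by linarith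
    moreover have "prod_mset M \<ge> 0" if "\<forall>x\<in>#M. x \<ge> 0" for M :: "int multiset"
      using that by (induction M) simp_all
    ultimately have "jacobi a n \<ge> 0"
      unfolding jacobi_def by blast
    with assms show False
      by simp
  qed
  then show ?thesis
    using that by (auto simp: in_prime_factors_iff)
qed

text \<open>For \<open>p\<close> congruent to 1 mod 4 the exponent \<open>(p - 1) div 2\<close> is
  even, so the sign in quadratic reciprocity is 1.\<close>

lemma Legendre_swap:
  assumes "prime p" "[p = 1] (mod 4)" "prime q" "2 < q"
  shows "Legendre (int q) (int p) = Legendre (int p) (int q)"
proof (cases "p = q")
  case False
  have "p > 2"
    using assms(1,2) prime_ge_2_nat[of p] by (cases "p = 2") (auto simp: cong_def)
  have "4 dvd p - 1"
    using assms(2) prime_ge_1_nat[OF assms(1)] by (simp add: cong_altdef_nat)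
  then obtain c where "p - 1 = 4 * c"
    by (rule dvdE)
  then have "even ((p - 1) div 2)"
    by simp
  then have "Legendre (int p) (int q) * Legendre (int q) (int p) = 1"
    using Quadratic_Reciprocity[OF assms(1) \<open>p > 2\<close> assms(3,4) False] by simp
  then show ?thesis
    using Legendre_cases[of "int p" "int q"] Legendre_cases[of "int q" "int p"] by auto
qed simp

text \<open>Each factor is swapped without a sign, and the swapped factors recombine by
  multiplicativity in the upper argument. The result depends on \<open>n\<close> only modulo
  \<open>q\<close>, which makes periodicity in the Fermat index accessible.\<close>

lemma jacobi_reciprocity:
  assumes "n > 0" "\<And>p. prime p \<Longrightarrow> p dvd n \<Longrightarrow> [p = 1] (mod 4)" "prime q" "2 < q"
  shows "jacobi (int q) n = Legendre (int n) (int q)"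
proof -
  have "(\<Prod>p\<in>#M. Legendre (int q) (int p)) = Legendre (int (prod_mset M)) (int q)"
    if "\<And>p. p \<in># M \<Longrightarrow> prime p \<and> [p = 1] (mod 4)" for M :: "nat multiset"
    using that
  proof (induction M)
    case empty
    then show ?case
      using Legendre_one[OF assms(3,4)] by simp
  next
    case (add p M)
    then show ?case
      using Legendre_swap[of p q] Legendre_mult[of q] assms(3,4) by simp
  qed
  from this[of "prime_factorization n"] show ?thesis
    using assms(1,2) by (auto simp: jacobi_def in_prime_factors_iff)
qed

section \<open>Fermat numbers\<close>

definition fermat :: "nat \<Rightarrow> nat" where
  "fermat k = 2 ^ (2 ^ k) + 1"

lemma odd_fermat: "odd (fermat k)"
  by (simp add: fermat_def)

text \<open>Modulo \<open>p\<close> the power \<open>x ^ 2 ^ m\<close> is -1, so its square is 1,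
  while it differs from 1 because \<open>p > 2\<close>. The order thus divides
  \<open>2 ^ (m + 1)\<close> but not \<open>2 ^ m\<close>.\<close>

lemma ord_eq_power_2:
  fixes p x :: nat
  assumes "p > 2" "p dvd x ^ 2 ^ m + 1"
  shows "ord p x = 2 ^ (m + 1)"
proof -
  have *: "[int x ^ 2 ^ m = -1] (mod int p)"
    using of_nat_dvd_iff[of p "x ^ 2 ^ m + 1", where ?'a = int] assms(2)
    by (simp add: cong_iff_dvd_diff add.commute)
  have "[int x ^ 2 ^ (m + 1) = 1] (mod int p)"
    using cong_mult[OF * *] by (simp add: power_add[symmetric] mult_2[symmetric])
  then have "[x ^ 2 ^ (m + 1) = 1] (mod p)"
    by (metis cong_int_iff of_nat_1 of_nat_power)
  then have "ord p x dvd 2 ^ (m + 1)"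
    by (simp only: ord_divides)
  then obtain i where i: "i \<le> m + 1" "ord p x = 2 ^ i"
    by (meson divides_primepow_nat two_is_prime_nat)
  have "\<not> i \<le> m"
  proof
    assume "i \<le> m"
    then have "ord p x dvd 2 ^ m"
      using i by (simp add: le_imp_power_dvd)
    then have "[x ^ 2 ^ m = 1] (mod p)"
      by (simp only: ord_divides)
    then have "[int x ^ 2 ^ m = 1] (mod int p)"
      by (metis cong_int_iff of_nat_1 of_nat_power)
    then have "[1 = -1] (mod int p)"
      using * cong_sym cong_trans by blast
    then have "int p dvd 2"
      by (simp add: cong_iff_dvd_diff)
    then show False
      using assms(1) zdvd_not_zless[of 2 "int p"] by auto
  qed
  then have "i = m + 1"
    using i(1) by simp
  then show ?thesis
    using i(2) by simp
qed

text \<open>This is Lucas's sharpening of Euler's result on divisors of Fermat numbers. A square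
  root \<open>y\<close> of 2 satisfies \<open>y ^ 2 ^ (k + 1) = 2 ^ 2 ^ k = -1\<close> mod
  \<open>p\<close>, so it has order \<open>2 ^ (k + 2)\<close>, which divides
  \<open>p - 1\<close>.\<close>

lemma prime_dvd_fermatD:
  assumes "prime p" "p dvd fermat k" "k \<ge> 2"
  shows "p > 2" "ord p 2 = 2 ^ (k + 1)" "2 ^ (k + 2) dvd p - 1" "Legendre 2 (int p) = 1"
proof -
  have "odd p"
    using assms(2) odd_fermat dvd_trans by blast
  then show p2: "p > 2"
    using prime_ge_2_nat[OF assms(1)] by (cases "p = 2") auto
  show "ord p 2 = 2 ^ (k + 1)"
    using ord_eq_power_2[OF p2, of 2 k] assms(2) by (simp add: fermat_def)
  \<comment> \<open>Modulo \<open>p\<close>, \<open>x\<close> is a primitive eighth root of unity;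
    the exponent \<open>k - 2\<close> is where \<open>k \<ge> 2\<close> enters.\<close>
  define x :: nat where "x = 2 ^ 2 ^ (k - 2)"
  define y where "y = int x ^ 3 - int x"
  obtain l where "k = l + 2"
    using assms(3) le_Suc_ex by (metis add.commute)
  then have "2 ^ k = 2 ^ (k - 2) * (4::nat)"
    by simp
  then have "x ^ 4 + 1 = fermat k"
    by (simp add: x_def fermat_def power_mult)
  then have x4: "int p dvd int x ^ 4 + 1"
    using assms(2) by (metis of_nat_1 of_nat_add of_nat_dvd_iff of_nat_power)
  \<comment> \<open>As \<open>x ^ 4 = -1\<close>, \<open>y = - (x + 1 / x)\<close> is a square root of 2.\<close>
  have "y ^ 2 - 2 = (int x ^ 4 + 1) * (int x ^ 2 - 2)"
    by (simp add: y_def algebra_simps power2_eq_square power3_eq_cube numeral_eq_Suc)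
  then have y2: "[y ^ 2 = 2] (mod int p)"
    using x4 by (simp add: cong_iff_dvd_diff)
  have "\<not> int p dvd 2"
    using p2 zdvd_not_zless[of 2 "int p"] by auto
  then show "Legendre 2 (int p) = 1"
    using y2 by (auto simp: Legendre_def QuadRes_def cong_0_iff)
  \<comment> \<open>\<open>ord_eq_power_2\<close> is about natural numbers, so \<open>y\<close> has
    to be the image of the natural number \<open>x ^ 3 - x\<close>; this inequality rules out
    truncated subtraction.\<close>
  have x1: "x \<le> x ^ 3"
    by (simp add: x_def power_increasing self_le_power)
  then have y: "y = int (x ^ 3 - x)"
    by (simp add: y_def)
  have "[y ^ 2 ^ (k + 1) = 2 ^ 2 ^ k] (mod int p)"
    using cong_pow[OF y2, of "2 ^ k"] by (simp add: power_mult[symmetric])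
  then have "[int ((x ^ 3 - x) ^ 2 ^ (k + 1) + 1) = int (fermat k)] (mod int p)"
    using cong_add[of "y ^ 2 ^ (k + 1)" "2 ^ 2 ^ k" "int p" 1 1] by (simp add: y fermat_def add.commute)
  then have "p dvd (x ^ 3 - x) ^ 2 ^ (k + 1) + 1"
    using assms(2) by (metis cong_int_iff cong_dvd_iff)
  from ord_eq_power_2[OF p2 this] have o: "ord p (x ^ 3 - x) = 2 ^ (k + 2)"
    by simp
  have "ord p (x ^ 3 - x) > 0"
    using o by simp
  then have "coprime p (x ^ 3 - x)"
    by (simp only: ord_gt_0_iff)
  from order_divides_totient[OF this] show "2 ^ (k + 2) dvd p - 1"
    using o totient_prime[OF assms(1)] by simp
qed

text \<open>With \<open>p - 1 = 2 ^ Suc m * s\<close>, Euler's criterion reads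
  \<open>(A ^ s) ^ 2 ^ m = -1\<close>. So \<open>A ^ s\<close> has order exactly
  \<open>2 ^ Suc m\<close>, and the order of a power divides that of \<open>A\<close>.\<close>

lemma ord_dvd_if_nonresidue:
  fixes A p :: nat
  assumes "prime p" "p > 2" "Legendre (int A) (int p) = -1" "2 ^ Suc m dvd p - 1"
  shows "2 ^ Suc m dvd ord p A"
proof -
  obtain s where s: "p - 1 = 2 ^ Suc m * s"
    using assms(4) by auto
  have "[-1 = int A ^ ((p - 1) div 2)] (mod int p)"
    using euler_criterion[OF assms(1,2), of "int A"] assms(3) by simp
  moreover have "(p - 1) div 2 = s * 2 ^ m"
    using s by simp
  ultimately have "[-1 = int ((A ^ s) ^ 2 ^ m)] (mod int p)"
    by (simp add: power_mult)
  then have "int p dvd -1 - int ((A ^ s) ^ 2 ^ m)"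
    by (simp only: cong_iff_dvd_diff)
  then have "int p dvd int ((A ^ s) ^ 2 ^ m + 1)"
    using dvd_minus_iff[of "int p" "-1 - int ((A ^ s) ^ 2 ^ m)"] by (simp add: add.commute)
  then have "p dvd (A ^ s) ^ 2 ^ m + 1"
    by (simp only: of_nat_dvd_iff)
  from ord_eq_power_2[OF assms(2) this] have o: "ord p (A ^ s) = 2 ^ Suc m"
    by simp
  have "[(A ^ s) ^ ord p A = 1] (mod p)"
    using cong_pow[OF ord[of A p], of s] by (simp add: power_mult[symmetric] mult.commute)
  then show ?thesis
    using o by (simp only: ord_divides)
qed

section \<open>Order-dominance over 2 from symbols -1 at Fermat numbers\<close>

lemma padic_unit_of_nat: "prime p \<Longrightarrow> padic_unit p (of_nat A) \<longleftrightarrow> \<not> p dvd A"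
  using not_prime_unit[of p] by (auto simp: padic_unit_def quotient_of_int[of "int A", simplified])

lemma ord_mod_prime_of_nat: "prime p \<Longrightarrow> ord_mod_prime p (of_nat A) = ord p A"
  using prime_gt_1_nat[of p]
  by (simp add: ord_mod_prime_def rat_mod_def quotient_of_int[of "int A", simplified]
      zmod_int[symmetric])

text \<open>A prime is chosen for each index. Distinct indices give distinct primes, because
  \<open>ord p 2 = 2 ^ (k + 1)\<close> determines \<open>k\<close>.\<close>

lemma infinite_jacobi_imp_order_dominant:
  fixes A :: nat
  assumes "A > 0" and inf: "infinite {k. jacobi (int A) (fermat k) = -1}"
  shows "order_dominant (of_nat A) 2"
proof -
  define K where "K = {k. jacobi (int A) (fermat k) = -1} - {..<2}"
  have "infinite K"
    unfolding K_def using inf by (simp add: Diff_infinite_finite)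
  have "\<forall>k\<in>K. \<exists>p. prime p \<and> p dvd fermat k \<and> Legendre (int A) (int p) = -1"
    unfolding K_def by (auto elim: jacobi_eq_minus_oneE)
  then obtain P where P: "\<And>k. k \<in> K \<Longrightarrow> prime (P k)" "\<And>k. k \<in> K \<Longrightarrow> P k dvd fermat k"
    "\<And>k. k \<in> K \<Longrightarrow> Legendre (int A) (int (P k)) = -1"
    by metis
  have K2: "k \<ge> 2" if "k \<in> K" for k
    using that by (auto simp: K_def)
  have ord2: "ord (P k) 2 = 2 ^ (k + 1)" if "k \<in> K" for k
    using prime_dvd_fermatD(2)[OF P(1,2) K2] that by blast
  have "inj_on P K"
  proof (rule inj_onI)
    fix k l assume *: "k \<in> K" "l \<in> K" "P k = P l"
    then have "(2::nat) ^ (k + 1) = 2 ^ (l + 1)"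
      using ord2 by metis
    then show "k = l"
      by simp
  qed
  with \<open>infinite K\<close> have "infinite (P ` K)"
    using finite_imageD by blast
  moreover have "P ` K \<subseteq> {p. prime p \<and> padic_unit p (of_nat A) \<and> padic_unit p 2 \<and>
       ord_mod_prime p (of_nat A) > ord_mod_prime p 2}"
  proof (intro image_subsetI CollectI conjI)
    fix k assume k: "k \<in> K"
    note D = prime_dvd_fermatD[OF P(1,2)[OF k] K2[OF k]]
    show "prime (P k)"
      by (rule P(1)[OF k])
    show "padic_unit (P k) (of_nat A)"
      using Legendre_eq_0_iff[OF P(1)[OF k], of "int A"] P(3)[OF k] padic_unit_of_nat[OF P(1)[OF k]]
      by simp
    show "padic_unit (P k) 2"
      using D(1) padic_unit_of_nat[OF P(1)[OF k], of 2] dvd_imp_le[of "P k" 2] by auto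
    have "ord (P k) A > 0"
      using P(1,3)[OF k] Legendre_eq_0_iff[OF P(1)[OF k], of "int A"]
      by (simp add: prime_imp_coprime)
    moreover have "2 ^ (k + 2) dvd ord (P k) A"
      using ord_dvd_if_nonresidue[OF P(1)[OF k] D(1) P(3)[OF k], of "k + 1"] D(3) by simp
    ultimately have "2 ^ (k + 2) \<le> ord (P k) A"
      using dvd_imp_le by blast
    moreover have "(2::nat) ^ (k + 1) < 2 ^ (k + 2)"
      by simp
    ultimately have "ord (P k) 2 < ord (P k) A"
      using ord2[OF k] by linarith
    then show "ord_mod_prime (P k) (of_nat A) > ord_mod_prime (P k) 2"
      using ord_mod_prime_of_nat[OF P(1)[OF k], of A] ord_mod_prime_of_nat[OF P(1)[OF k], of 2] by simp
  qed
  \<comment> \<open>\<open>order_dominant\<close> also demands that \<open>A\<close> is none of 0,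
    1, -1; the number 1 has symbol 1 everywhere.\<close>
  moreover have "A \<noteq> 1"
    using inf by (auto simp: jacobi_one odd_fermat)
  moreover have "(of_nat A :: rat) \<noteq> - 1"
    using of_nat_0_le_iff[of A, where ?'a = rat] by linarith
  ultimately show ?thesis
    using assms(1) finite_subset unfolding order_dominant_def by auto
qed

section \<open>Recurrence of residues and symbols in the Fermat index\<close>

lemma fermat_cong_recurrence:
  fixes k q :: nat
  assumes "odd q" "\<not> 2 ^ Suc k dvd q - 1" "prime q"
  obtains T where "T > 0" "\<And>n. [fermat (k + n * T) = fermat k] (mod q)"
proof -
  have "q - 1 \<noteq> 0"
    using prime_gt_1_nat[OF assms(3)] by simp
  \<comment> \<open>By hypothesis the 2-adic valuation \<open>v\<close> of \<open>q - 1\<close> is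
    at most \<open>k\<close>. So for indices from \<open>k\<close> on, the exponent
    \<open>2 ^ l\<close> is already 0 modulo \<open>2 ^ v\<close>, and only its residue modulo the
    odd part \<open>s\<close> can vary, with period \<open>totient s\<close>.\<close>
  then obtain v s where vs: "q - 1 = 2 ^ v * s" "odd s"
    using multiplicity_decompose'[of "q - 1" 2] by (metis odd_one)
  have "v \<le> k"
    using assms(2) vs(1) le_imp_power_dvd[of "Suc k" v "2::nat"] by (metis dvd_mult2 not_less_eq_eq)
  have s0: "s > 0"
    using vs(2) by (cases s) auto
  have *: "[fermat (k + n * totient s) = fermat k] (mod q)" for n
  proof -
    have "[2 ^ (n * totient s) = 1] (mod s)"
      using cong_pow[OF euler_theorem[of 2 s], of n] vs(2)
      by (simp add: power_mult[symmetric] mult.commute)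
    \<comment> \<open>Multiplication by \<open>2 ^ k\<close> lifts the congruence from
      \<open>s\<close> to \<open>2 ^ k * s\<close>, a multiple of \<open>q - 1\<close> and hence of
      \<open>ord q 2\<close>.\<close>
    then have "[2 ^ k * 2 ^ (n * totient s) = 2 ^ k * 1] (mod (2 ^ k * s))"
      unfolding cong_def by (simp only: mult_mod_right[symmetric])
    moreover have "q - 1 dvd 2 ^ k * s"
      unfolding vs(1) using \<open>v \<le> k\<close> by (intro mult_dvd_mono le_imp_power_dvd) auto
    ultimately have e: "[2 ^ (k + n * totient s) = 2 ^ k] (mod (q - 1))"
      by (metis cong_dvd_modulus_nat mult.right_neutral power_add)
    have c: "coprime q 2"
      using assms(1) by (simp add: coprime_commute)
    have "ord q 2 dvd q - 1"
      using order_divides_totient[OF c] totient_prime[OF assms(3)] by simp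
    with e have "[2 ^ (k + n * totient s) = 2 ^ k] (mod (ord q 2))"
      by (rule cong_dvd_modulus_nat)
    then have "[2 ^ 2 ^ (k + n * totient s) = 2 ^ 2 ^ k] (mod q)"
      by (simp only: order_divides_expdiff[OF c])
    then show ?thesis
      unfolding fermat_def by (intro cong_add) auto
  qed
  show ?thesis
    using that[of "totient s"] * s0 by simp
qed

text \<open>For \<open>q = 2\<close> the symbol is constantly 1, since 2 is a square modulo every
  prime factor. For odd \<open>q\<close>, reciprocity reduces the symbol to the residue of the
  Fermat number mod \<open>q\<close>, which recurs.\<close>

lemma jacobi_fermat_prime_recurrence:
  assumes "prime q" "k \<ge> 2" "q = 2 \<or> \<not> 2 ^ Suc k dvd q - 1"
  shows "\<exists>T>0. \<forall>n. jacobi (int q) (fermat (k + n * T)) = jacobi (int q) (fermat k)"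
proof (cases "q = 2")
  case True
  have "jacobi 2 (fermat l) = 1" if "l \<ge> 2" for l
  proof -
    have "jacobi 2 (fermat l) = (\<Prod>p\<in>#prime_factorization (fermat l). 1)"
      unfolding jacobi_def
      by (intro arg_cong[of _ _ prod_mset] image_mset_cong)
        (use prime_dvd_fermatD(4) that in \<open>auto simp: in_prime_factors_iff\<close>)
    then show ?thesis
      by simp
  qed
  then show ?thesis
    using True assms(2) by (intro exI[of _ 1]) auto
next
  case False
  then have q: "odd q" "2 < q"
    using assms(1) prime_ge_2_nat[OF assms(1)] prime_odd_nat[of q] by auto
  obtain T where T: "T > 0" "\<And>n. [fermat (k + n * T) = fermat k] (mod q)"
    using fermat_cong_recurrence[OF q(1) _ assms(1)] False assms(3) by blast
  have *: "jacobi (int q) (fermat l) = Legendre (int (fermat l)) (int q)" if l: "l \<ge> 2" for l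
  proof (rule jacobi_reciprocity[OF _ _ assms(1) q(2)])
    fix p assume p: "prime p" "p dvd fermat l"
    have "4 dvd p - 1"
      using prime_dvd_fermatD(3)[OF p l] dvd_trans[of 4 "2 ^ (l + 2)" "p - 1"]
        le_imp_power_dvd[of 2 "l + 2" "2::nat"] by simp
    then show "[p = 1] (mod 4)"
      using prime_ge_1_nat[OF p(1)] by (simp add: cong_altdef_nat cong_sym_eq)
  qed (simp add: fermat_def)
  have "jacobi (int q) (fermat (k + n * T)) = jacobi (int q) (fermat k)" for n
    using *[of "k + n * T"] *[of k] assms(2) Legendre_cong T(2)[of n] by (simp add: cong_int_iff)
  then show ?thesis
    using T(1) by blast
qed

text \<open>The symbol is multiplicative in \<open>A\<close>, and the product of the periods of the
  factors is a common period.\<close>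

lemma jacobi_fermat_recurrence:
  fixes A k :: nat
  assumes "A > 0" "k \<ge> 2" "\<And>q. prime q \<Longrightarrow> q dvd A \<Longrightarrow> q = 2 \<or> \<not> 2 ^ Suc k dvd q - 1"
  shows "\<exists>T>0. \<forall>n. jacobi (int A) (fermat (k + n * T)) = jacobi (int A) (fermat k)"
proof -
  have "\<exists>T>0. \<forall>n. jacobi (int (\<Prod>\<^sub># M)) (fermat (k + n * T)) = jacobi (int (\<Prod>\<^sub># M)) (fermat k)"
    if "\<And>q. q \<in># M \<Longrightarrow> prime q \<and> (q = 2 \<or> \<not> 2 ^ Suc k dvd q - 1)" for M :: "nat multiset"
    using that
  proof (induction M)
    case empty
    then show ?case
      by (auto simp: jacobi_one odd_fermat)
  next
    case (add q M)
    obtain T where T: "T > 0" "\<And>n. jacobi (int (\<Prod>\<^sub># M)) (fermat (k + n * T)) = jacobi (int (\<Prod>\<^sub># M)) (fermat k)"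
      using add by auto
    obtain U where U: "U > 0" "\<And>n. jacobi (int q) (fermat (k + n * U)) = jacobi (int q) (fermat k)"
      using jacobi_fermat_prime_recurrence[of q k] add.prems[of q] assms(2) by auto
    have "jacobi (int q) (fermat (k + n * (T * U))) = jacobi (int q) (fermat k)"
      and "jacobi (int (\<Prod>\<^sub># M)) (fermat (k + n * (T * U))) = jacobi (int (\<Prod>\<^sub># M)) (fermat k)" for n
      using U(2)[of "n * T"] T(2)[of "n * U"] by (simp_all add: ac_simps)
    then have "\<forall>n. jacobi (int (\<Prod>\<^sub># (add_mset q M))) (fermat (k + n * (T * U)))
        = jacobi (int (\<Prod>\<^sub># (add_mset q M))) (fermat k)"
      by (simp add: jacobi_mult odd_fermat)
    then show ?case
      using T(1) U(1) by (intro exI[of _ "T * U"]) simp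
  qed
  from this[of "prime_factorization A"] show ?thesis
    using assms by (auto simp: in_prime_factors_iff)
qed

text \<open>Without a prime factor congruent to 1 mod \<open>2 ^ Suc k\<close>, a symbol -1 at any
  \<open>l \<ge> k\<close> would recur infinitely often and make \<open>A\<close> dominate 2. The
  symbol 0 is impossible too: a common prime factor of \<open>A\<close> and \<open>fermat l\<close>
  would itself be congruent to 1 mod \<open>2 ^ Suc k\<close>.\<close>

lemma not_order_dominant_cases:
  fixes A k J :: nat
  assumes "A > 0" "k \<ge> 2" "\<not> order_dominant (of_nat A) 2"
  shows "(\<forall>l\<ge>k. jacobi (int A) (fermat l) = 1) \<or>
         (\<exists>q. prime q \<and> q dvd A \<and> [q = 1] (mod 2 ^ Suc k))"
proof (rule disjCI)
  assume "\<not> (\<exists>q. prime q \<and> q dvd A \<and> [q = 1] (mod 2 ^ Suc k))"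
  then have q: "\<not> 2 ^ Suc k dvd q - 1" if "prime q" "q dvd A" for q
    using that prime_ge_1_nat[of q] by (auto simp: cong_altdef_nat cong_sym_eq)
  have q': "\<not> 2 ^ Suc l dvd q - 1" if "prime q" "q dvd A" "l \<ge> k" for q l
    using q[OF that(1,2)] le_imp_power_dvd[of "Suc k" "Suc l" "2::nat"] that(3) dvd_trans by blast
  show "\<forall>l\<ge>k. jacobi (int A) (fermat l) = 1"
  proof (intro allI impI)
    fix l assume l: "k \<le> l"
    have "jacobi (int A) (fermat l) \<noteq> -1"
    proof
      assume m1: "jacobi (int A) (fermat l) = -1"
      obtain T where T: "T > 0" "\<And>n. jacobi (int A) (fermat (l + n * T)) = jacobi (int A) (fermat l)"
        using jacobi_fermat_recurrence[of A l] q'[OF _ _ l] assms(1,2) l by auto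
      have "inj (\<lambda>n. l + n * T)"
        using T(1) by (auto intro: injI)
      then have "infinite (range (\<lambda>n. l + n * T))"
        using finite_imageD infinite_UNIV_nat by blast
      moreover have "range (\<lambda>n. l + n * T) \<subseteq> {k. jacobi (int A) (fermat k) = -1}"
        using T(2) m1 by auto
      ultimately have "infinite {k. jacobi (int A) (fermat k) = -1}"
        using finite_subset by blast
      then show False
        using infinite_jacobi_imp_order_dominant assms(1,3) by blast
    qed
    moreover have "coprime A (fermat l)"
    proof (rule ccontr)
      assume "\<not> coprime A (fermat l)"
      then have "gcd A (fermat l) \<noteq> 1"
        using coprime_iff_gcd_eq_1 by blast
      then obtain p where "prime p" "p dvd gcd A (fermat l)"
        using prime_factor_nat by blast
      then have p: "prime p" "p dvd A" "p dvd fermat l"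
        by simp_all
      have "2 ^ Suc l dvd p - 1"
        using prime_dvd_fermatD(3)[OF p(1,3)] assms(2) l le_imp_power_dvd[of "Suc l" "l + 2" "2::nat"]
          dvd_trans by fastforce
      then show False
        using q'[OF p(1,2) l] by blast
    qed
    ultimately show "jacobi (int A) (fermat l) = 1"
      using jacobi_cases_coprime by blast
  qed
qed

section \<open>Jacobi symbols at consecutive Fermat numbers\<close>

lemma fermat_mod_3:
  assumes "k \<ge> 1"
  shows "fermat k mod 3 = 2"
proof -
  obtain l where "k = Suc l"
    using assms by (cases k) auto
  then have "fermat k = 4 ^ 2 ^ l + 1"
    by (simp add: fermat_def power_mult)
  moreover have "[4 ^ 2 ^ l = 1 ^ 2 ^ l] (mod (3::nat))"
    by (intro cong_pow) (simp add: cong_def)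
  then have "(4::nat) ^ 2 ^ l mod 3 = 1"
    by (simp add: cong_def)
  ultimately show ?thesis
    by (simp add: mod_Suc)
qed

text \<open>Provides one fixed multiplier that flips the symbol over every Fermat number of index at
  least 2.\<close>

lemma jacobi_3_fermat:
  assumes "k \<ge> 2"
  shows "jacobi 3 (fermat k) = -1"
proof -
  have "jacobi (int 3) (fermat k) = Legendre (int (fermat k)) (int 3)"
  proof (rule jacobi_reciprocity)
    fix p assume p: "prime p" "p dvd fermat k"
    have "4 dvd p - 1"
      using prime_dvd_fermatD(3)[OF p assms] dvd_trans[of 4 "2 ^ (k + 2)" "p - 1"]
        le_imp_power_dvd[of 2 "k + 2" "2::nat"] by simp
    then show "[p = 1] (mod 4)"
      using prime_ge_1_nat[OF p(1)] by (simp add: cong_altdef_nat cong_sym_eq)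
  qed (auto simp: fermat_def)
  moreover have "[fermat k = 2] (mod 3)"
    using fermat_mod_3[of k] assms by (simp add: cong_def)
  then have "[int (fermat k) = int 2] (mod int 3)"
    by (simp only: cong_int_iff)
  then have "Legendre (int (fermat k)) (int 3) = Legendre 2 3"
    using Legendre_cong by simp
  moreover have "Legendre 2 3 = -1"
    using euler_criterion[of 3 2] Legendre_cases[of 2 3] by (auto simp: cong_def)
  ultimately show ?thesis
    by simp
qed

text \<open>Multiplication by 3 maps the residues with symbol 1 injectively to residues with symbol
  -1, so the former make up at most half of all residues.\<close>

lemma card_jacobi_eq_1:
  assumes "k \<ge> 2"
  shows "2 * card {a. a < fermat k \<and> jacobi (int a) (fermat k) = 1} \<le> fermat k"
proof -
  define T where "T = {a. a < fermat k \<and> jacobi (int a) (fermat k) = 1}"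
  define g where "g a = 3 * a mod fermat k" for a
  have "\<not> 3 dvd fermat k"
    using fermat_mod_3[of k] assms by (auto simp: dvd_eq_mod_eq_0)
  then have "coprime 3 (fermat k)"
    by (intro prime_imp_coprime) auto
  then have "inj_on g T"
    by (auto simp: inj_on_def g_def T_def cong_def[symmetric] cong_mult_lcancel_nat)
      (simp add: cong_def)
  have F: "fermat k > 0"
    by (simp add: fermat_def)
  have "jacobi (int (g a)) (fermat k) = -1" if "a \<in> T" for a
    using that jacobi_3_fermat[OF assms] jacobi_mod[of "3 * a" "fermat k"]
      jacobi_mult[OF odd_fermat, of 3 "int a" k]
    by (simp add: g_def T_def)
  then have "T \<inter> g ` T = {}"
    by (auto simp: T_def)
  moreover have "T \<union> g ` T \<subseteq> {..<fermat k}"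
    using F by (auto simp: T_def g_def)
  moreover have "finite T"
    by (simp add: T_def)
  ultimately have "card T + card (g ` T) \<le> fermat k"
    using card_mono[of "{..<fermat k}" "T \<union> g ` T"] by (simp add: card_Un_disjoint)
  then show ?thesis
    using card_image[OF \<open>inj_on g T\<close>] by (simp add: T_def)
qed

text \<open>A common prime factor would give 2 two different orders.\<close>

lemma coprime_fermat:
  assumes "k \<ge> 2" "l \<ge> 2" "k \<noteq> l"
  shows "coprime (fermat k) (fermat l)"
proof (rule ccontr)
  assume "\<not> ?thesis"
  then have "gcd (fermat k) (fermat l) \<noteq> 1"
    using coprime_iff_gcd_eq_1 by blast
  then obtain p where "prime p" "p dvd gcd (fermat k) (fermat l)"
    using prime_factor_nat by blast
  then have "ord p 2 = 2 ^ (k + 1)" "ord p 2 = 2 ^ (l + 1)"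
    using prime_dvd_fermatD(2) assms by simp_all
  then show False
    using assms(3) by simp
qed

lemma card_crt_le:
  fixes m n :: nat
  assumes "coprime m n"
  shows "card {a. a < m * n \<and> P (a mod m) \<and> Q (a mod n)} \<le> card {a. a < m \<and> P a} * card {a. a < n \<and> Q a}"
proof (cases "m = 0 \<or> n = 0")
  case False
  define f where "f a = (a mod m, a mod n)" for a
  let ?X = "{a. a < m * n \<and> P (a mod m) \<and> Q (a mod n)}"
  have "inj_on f ?X"
  proof (rule inj_onI)
    fix a b assume ab: "a \<in> ?X" "b \<in> ?X" "f a = f b"
    then have "[a = b] (mod m * n)"
      using assms by (intro coprime_cong_mult_nat) (auto simp: f_def cong_def)
    then show "a = b"
      using ab by (simp add: cong_def)
  qed
  moreover have "f ` ?X \<subseteq> {a. a < m \<and> P a} \<times> {a. a < n \<and> Q a}"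
    using False by (auto simp: f_def)
  ultimately have "card ?X \<le> card ({a. a < m \<and> P a} \<times> {a. a < n \<and> Q a})"
    by (intro card_inj_on_le) auto
  then show ?thesis
    by (simp add: card_cartesian_product)
qed auto

text \<open>The quotients \<open>A div P\<close> run through 0 up to \<open>N div P\<close>, which
  accounts for the \<open>+ 1\<close>; each of them admits every good residue at most once.\<close>

lemma card_mod_le:
  fixes P :: nat
  assumes "P > 0"
  shows "card {A \<in> {1..N}. Q (A mod P)} \<le> (N div P + 1) * card {a. a < P \<and> Q a}"
proof -
  define f where "f a = (a div P, a mod P)" for a
  let ?X = "{A \<in> {1..N}. Q (A mod P)}"
  have "inj_on f ?X"
  proof (rule inj_onI)
    fix a b assume "f a = f b"
    then have "a div P = b div P" "a mod P = b mod P"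
      by (simp_all add: f_def)
    then show "a = b"
      by (metis div_mult_mod_eq)
  qed
  moreover have "f ` ?X \<subseteq> {..N div P} \<times> {a. a < P \<and> Q a}"
    using assms by (auto simp: f_def div_le_mono)
  ultimately have "card ?X \<le> card ({..N div P} \<times> {a. a < P \<and> Q a})"
    by (intro card_inj_on_le) auto
  then show ?thesis
    by (simp add: card_cartesian_product)
qed

lemma jacobi_mod_dvd:
  assumes "n dvd m"
  shows "jacobi (int (a mod m)) n = jacobi (int a) n"
  using cong_dvd_modulus_nat[of "a mod m" a m n] assms
  by (intro jacobi_cong) (simp add: cong_int_iff)

text \<open>By the Chinese remainder theorem the conditions at coprime Fermat numbers are
  independent, and each one at least halves the proportion.\<close>

lemma card_jacobi_fermat_eq_1:
  assumes "k \<ge> 2"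
  defines "P \<equiv> \<lambda>J. \<Prod>j<J. fermat (k + j)"
  shows "2 ^ J * card {a. a < P J \<and> (\<forall>j<J. jacobi (int a) (fermat (k + j)) = 1)} \<le> P J"
proof (induction J)
  case 0
  then show ?case
    by (simp add: P_def)
next
  case (Suc J)
  define S where "S J = {a. a < P J \<and> (\<forall>j<J. jacobi (int a) (fermat (k + j)) = 1)}" for J
  let ?F = "fermat (k + J)"
  let ?T = "{a. a < ?F \<and> jacobi (int a) ?F = 1}"
  have PS: "P (Suc J) = P J * ?F"
    by (simp add: P_def)
  have "coprime (P J) ?F"
    unfolding P_def using assms(1) by (intro prod_coprime_left coprime_fermat) auto
  have dvd: "fermat (k + j) dvd P J" if "j < J" for j
    unfolding P_def using that by (intro dvd_prodI) auto
  \<comment> \<open>Each condition is expressed through the residue modulo its own factor, the form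
    that \<open>card_crt_le\<close> takes.\<close>
  have S: "S (Suc J) = {a. a < P J * ?F \<and> (\<forall>j<J. jacobi (int (a mod P J)) (fermat (k + j)) = 1)
      \<and> jacobi (int (a mod ?F)) ?F = 1}"
    using jacobi_mod_dvd[OF dvd] by (simp add: S_def PS All_less_Suc jacobi_mod conj_commute)
  have "card (S (Suc J)) \<le> card (S J) * card ?T"
    unfolding S unfolding S_def by (rule card_crt_le[OF \<open>coprime (P J) ?F\<close>])
  then have "2 ^ Suc J * card (S (Suc J)) \<le> 2 ^ Suc J * (card (S J) * card ?T)"
    by (rule mult_left_mono) simp
  also have "\<dots> = (2 ^ J * card (S J)) * (2 * card ?T)"
    by simp
  also have "\<dots> \<le> P J * ?F"
    using Suc.IH card_jacobi_eq_1[of "k + J"] assms(1) by (intro mult_mono) (auto simp: S_def)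
  finally show ?case
    by (simp only: PS S_def)
qed

text \<open>The product telescopes after multiplication by \<open>2 ^ 2 ^ k - 1\<close>, each step
  being a difference of two squares.\<close>

lemma prod_fermat_le: "(\<Prod>j<J. fermat (k + j)) \<le> 2 ^ 2 ^ (k + J)"
proof -
  have *: "int (\<Prod>j<J. fermat (k + j)) * (2 ^ 2 ^ k - 1) = 2 ^ 2 ^ (k + J) - 1"
  proof (induction J)
    case (Suc J)
    have "int (\<Prod>j<Suc J. fermat (k + j)) * (2 ^ 2 ^ k - 1) = (2 ^ 2 ^ (k + J) - 1) * (2 ^ 2 ^ (k + J) + 1)"
      unfolding Suc.IH[symmetric] by (simp add: fermat_def algebra_simps)
    also have "\<dots> = 2 ^ 2 ^ (k + Suc J) - 1"
      by (simp add: algebra_simps mult_2 power_add)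
    finally show ?case .
  qed simp
  have "int (\<Prod>j<J. fermat (k + j)) * 1 \<le> int (\<Prod>j<J. fermat (k + j)) * (2 ^ 2 ^ k - 1)"
    using self_le_power[of "2::int" "2 ^ k"] by (intro mult_left_mono of_nat_0_le_iff) auto
  then have "int (\<Prod>j<J. fermat (k + j)) \<le> int (2 ^ 2 ^ (k + J))"
    unfolding * by simp
  then show ?thesis
    by (simp only: of_nat_le_iff)
qed

text \<open>The product \<open>P\<close> of the Fermat numbers is at most \<open>N\<close>, so
  rounding up to whole periods of length \<open>P\<close> costs at most a factor 2.\<close>

lemma card_jacobi_fermat_le:
  assumes "k \<ge> 2" "2 ^ 2 ^ (k + J) \<le> N"
  shows "2 ^ J * card {A \<in> {1..N}. \<forall>j<J. jacobi (int A) (fermat (k + j)) = 1} \<le> 2 * N"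
proof -
  define P where "P = (\<Prod>j<J. fermat (k + j))"
  define Q where "Q a \<longleftrightarrow> (\<forall>j<J. jacobi (int a) (fermat (k + j)) = 1)" for a
  have "P > 0"
    by (simp add: P_def fermat_def prod_pos)
  have dvd: "fermat (k + j) dvd P" if "j < J" for j
    unfolding P_def using that by (intro dvd_prodI) auto
  have "Q (A mod P) \<longleftrightarrow> Q A" for A
    unfolding Q_def using jacobi_mod_dvd[OF dvd] by auto
  then have "2 ^ J * card {A \<in> {1..N}. Q A} \<le> 2 ^ J * ((N div P + 1) * card {a. a < P \<and> Q a})"
    using card_mod_le[OF \<open>P > 0\<close>, of N Q] by simp
  also have "\<dots> = (N div P + 1) * (2 ^ J * card {a. a < P \<and> Q a})"
    by (simp only: ac_simps)
  also have "\<dots> \<le> (N div P + 1) * P"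
    using card_jacobi_fermat_eq_1[OF assms(1), of J] by (intro mult_left_mono) (auto simp: P_def Q_def)
  also have "\<dots> = N div P * P + P"
    by simp
  also have "\<dots> \<le> N + N"
    using prod_fermat_le[of k J] assms(2) by (intro add_mono) (auto simp: P_def)
  finally show ?thesis
    by (simp add: Q_def)
qed

section \<open>Sieving by a modulus with few coprime residues\<close>

text \<open>Each dyadic block of indices has \<open>2 ^ m\<close> terms of size at least
  \<open>1 / 2 ^ (m + 2)\<close> and so contributes at least 1/4.\<close>

lemma sum_inverse_odd_ge: "real m / 4 \<le> (\<Sum>i<2 ^ m. 1 / real (2 * i + 1))"
proof (induction m)
  case (Suc m)
  have "1 / 4 = real (card {2 ^ m..<2 ^ Suc m :: nat}) * (1 / (2 * 2 ^ Suc m))"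
    by simp
  also have "\<dots> \<le> (\<Sum>i = 2 ^ m..<2 ^ Suc m. 1 / real (2 * i + 1))"
  proof (rule sum_bounded_below)
    fix i :: nat assume "i \<in> {2 ^ m..<2 ^ Suc m}"
    then have "2 * i + 1 \<le> 2 * 2 ^ Suc m"
      by simp
    then have "real (2 * i + 1) \<le> real (2 * 2 ^ Suc m)"
      by (simp only: of_nat_le_iff)
    then have "real (2 * i + 1) \<le> 2 * 2 ^ Suc m"
      by simp
    then show "1 / (2 * 2 ^ Suc m) \<le> 1 / real (2 * i + 1)"
      by (intro divide_left_mono) auto
  qed
  finally have "real (Suc m) / 4 \<le> (\<Sum>i<2 ^ m. 1 / real (2 * i + 1)) + (\<Sum>i = 2 ^ m..<2 ^ Suc m. 1 / real (2 * i + 1))"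
    using Suc.IH by simp
  also have "\<dots> = (\<Sum>i<2 ^ Suc m. 1 / real (2 * i + 1))"
    by (simp only: lessThan_atLeast0) (intro sum.atLeastLessThan_concat, auto)
  finally show ?case .
qed simp

lemma sum_inverse_le:
  assumes "N < 2 ^ e"
  shows "(\<Sum>b = 1..N. 1 / real b) \<le> real e"
proof -
  have "(\<Sum>b = 1..<2 ^ e. 1 / real b) \<le> real e"
  proof (induction e)
    case (Suc e)
    have "(\<Sum>b = 1..<2 ^ Suc e. 1 / real b) = (\<Sum>b = 1..<2 ^ e. 1 / real b) + (\<Sum>b = 2 ^ e..<2 ^ Suc e. 1 / real b)"
      by (intro sum.atLeastLessThan_concat[symmetric]) auto
    also have "(\<Sum>b = 2 ^ e..<2 ^ Suc e. 1 / real b) \<le> real (card {2 ^ e..<2 ^ Suc e :: nat}) * (1 / 2 ^ e)"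
    proof (rule sum_bounded_above)
      fix b :: nat assume "b \<in> {2 ^ e..<2 ^ Suc e}"
      then have "2 ^ e \<le> real b"
        by (metis atLeastLessThan_iff of_nat_le_iff of_nat_numeral of_nat_power)
      then show "1 / real b \<le> 1 / 2 ^ e"
        by (intro divide_left_mono) (auto intro!: mult_pos_pos less_le_trans[of 0 "2 ^ e" "real b"])
    qed
    finally show ?case
      using Suc.IH by simp
  qed simp
  moreover have "(\<Sum>b = 1..N. 1 / real b) \<le> (\<Sum>b = 1..<2 ^ e. 1 / real b)"
    using assms by (intro sum_mono2) auto
  ultimately show ?thesis
    by linarith
qed

text \<open>Coprimality to \<open>W\<close> has period \<open>W\<close>, and the range consists of
  \<open>c\<close> periods.\<close>

lemma card_coprime_ge:
  fixes W c :: nat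
  shows "c * card {x. x < W \<and> coprime x W} \<le> card {u. u < c * W \<and> coprime u W}"
proof -
  let ?R = "{x. x < W \<and> coprime x W}"
  define f where "f = (\<lambda>(q, x). q * W + x)"
  have "inj_on f ({..<c} \<times> ?R)"
  proof (rule inj_onI, clarify)
    fix q x q' x' assume *: "x < W" "x' < W" "f (q, x) = f (q', x')"
    then have "(q * W + x) div W = (q' * W + x') div W" "(q * W + x) mod W = (q' * W + x') mod W"
      by (simp_all add: f_def)
    then show "q = q' \<and> x = x'"
      using *(1,2) by simp
  qed
  moreover have "f ` ({..<c} \<times> ?R) \<subseteq> {u. u < c * W \<and> coprime u W}"
  proof (clarsimp simp: f_def)
    fix q x assume "q < c" "x < W" "coprime x W"
    then have "Suc q * W \<le> c * W"
      by (intro mult_right_mono) auto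
    moreover have "coprime (q * W + x) W \<longleftrightarrow> coprime x W"
      by (simp only: coprime_iff_gcd_eq_1 gcd.commute[of _ W] gcd_add_mult)
    ultimately show "q * W + x < c * W \<and> coprime (q * W + x) W"
      using \<open>x < W\<close> \<open>coprime x W\<close> by simp
  qed
  ultimately have "card ({..<c} \<times> ?R) \<le> card {u. u < c * W \<and> coprime u W}"
    by (intro card_inj_on_le) auto
  then show ?thesis
    by (simp add: card_cartesian_product)
qed

text \<open>
  If \<open>W\<close> is the product of the odd numbers \<open>n\<close> below some bound, the sets of multiples \<open>n * u\<close> with
  \<open>u\<close> coprime to \<open>W\<close> are disjoint and have density \<open>1 / n\<close> times that of the \<open>u\<close>, so the divergence
  of the sum of the \<open>1 / n\<close> makes the latter density small.
\<close>

lemma ex_small_coprime_density: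
  fixes m :: nat
  shows "\<exists>W. odd W \<and> m * card {x. x < W \<and> coprime x W} \<le> W"
proof -
  \<comment> \<open>With this many odd numbers, \<open>sum_inverse_odd_ge\<close> makes the sum of
    their inverses at least \<open>m\<close>.\<close>
  define y :: nat where "y = 2 ^ (4 * m)"
  define W where "W = (\<Prod>i<y. 2 * i + 1)"
  define t where "t = card {x. x < W \<and> coprime x W}"
  \<comment> \<open>For \<open>i < y\<close> the cutoff is \<open>W div (2 * i + 1)\<close> full
    periods, and it keeps all multiples \<open>(2 * i + 1) * u\<close> below the common bound
    \<open>W * W\<close>.\<close>
  define U where "U i = {u. u < (W div (2 * i + 1)) * W \<and> coprime u W}" for i
  define V where "V i = (*) (2 * i + 1) ` U i" for i
  have W: "odd W"
    by (simp add: W_def even_prod_iff)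
  then have "W > 0"
    by (cases W) auto
  have dvd: "2 * i + 1 dvd W" if "i < y" for i
    unfolding W_def using that by (intro dvd_prodI) auto
  \<comment> \<open>Since \<open>u\<close> and \<open>v\<close> are coprime to \<open>W\<close>,
    they are coprime to the odd factors; an equality of multiples makes the two odd numbers divide
    each other.\<close>
  have disj: "V i \<inter> V j = {}" if ij: "i < y" "j < y" "i \<noteq> j" for i j
  proof (rule ccontr)
    assume "V i \<inter> V j \<noteq> {}"
    then obtain u v where uv: "coprime u W" "coprime v W" "(2 * i + 1) * u = (2 * j + 1) * v"
      by (auto simp: V_def U_def)
    have "coprime (2 * i + 1) v" "coprime (2 * j + 1) u"
      using uv(1,2) dvd ij(1,2) coprime_divisors[OF _ dvd_refl] coprime_commute by blast+
    moreover have "2 * i + 1 dvd (2 * j + 1) * v" "2 * j + 1 dvd (2 * i + 1) * u"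
      using uv(3) by (metis dvd_triv_left)+
    ultimately have "2 * i + 1 dvd 2 * j + 1" "2 * j + 1 dvd 2 * i + 1"
      by (simp_all only: coprime_dvd_mult_left_iff)
    then have "2 * i + 1 = 2 * j + 1"
      by (rule dvd_antisym)
    with ij(3) show False
      by simp
  qed
  have V: "(W div (2 * i + 1)) * t \<le> card (V i)" for i
  proof -
    have "card (V i) = card (U i)"
      unfolding V_def by (intro card_image inj_onI) (simp only: mult_cancel1, simp)
    then show ?thesis
      using card_coprime_ge[of "W div (2 * i + 1)" W] by (simp add: t_def U_def)
  qed
  have fin: "finite (V i)" for i
    by (simp add: V_def U_def)
  have sub: "V i \<subseteq> {..<W * W}" if "i < y" for i
  proof -
    have "(2 * i + 1) * u < W * W" if "u < (W div (2 * i + 1)) * W" for u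
    proof -
      have "(2 * i + 1) * u < (2 * i + 1) * ((W div (2 * i + 1)) * W)"
        using that by (intro mult_strict_left_mono) auto
      also have "\<dots> = W * W"
        using dvd_mult_div_cancel[OF dvd[OF \<open>i < y\<close>]] by (simp only: mult.assoc[symmetric])
      finally show ?thesis .
    qed
    then show ?thesis
      by (auto simp: V_def U_def)
  qed
  have "(\<Sum>i<y. (W div (2 * i + 1)) * t) \<le> (\<Sum>i<y. card (V i))"
    by (intro sum_mono V)
  also have "\<dots> = card (\<Union>i<y. V i)"
    using disj fin by (intro card_UN_disjoint[symmetric]) auto
  also have "\<dots> \<le> card {..<W * W}"
    using sub by (intro card_mono) auto
  finally have "real (\<Sum>i<y. (W div (2 * i + 1)) * t) \<le> real (W * W)"
    by (simp only: of_nat_le_iff card_lessThan)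
  moreover have "real (\<Sum>i<y. (W div (2 * i + 1)) * t) = real W * real t * (\<Sum>i<y. 1 / real (2 * i + 1))"
    unfolding of_nat_sum sum_distrib_left
    by (intro sum.cong) (use dvd in \<open>auto simp del: of_nat_Suc of_nat_add simp: real_of_nat_div\<close>)
  ultimately have "real W * (real t * (\<Sum>i<y. 1 / real (2 * i + 1))) \<le> real W * real W"
    by (simp add: mult.assoc)
  then have "real t * (\<Sum>i<y. 1 / real (2 * i + 1)) \<le> real W"
    using \<open>W > 0\<close> by simp
  moreover have "real t * real m \<le> real t * (\<Sum>i<y. 1 / real (2 * i + 1))"
    using sum_inverse_odd_ge[of "4 * m"] by (intro mult_left_mono) (auto simp: y_def)
  ultimately have "real (m * t) \<le> real W"
    by (simp add: mult.commute)
  then show ?thesis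
    using W unfolding t_def of_nat_le_iff by blast
qed

text \<open>The \<open>n\<close> are grouped into blocks of length \<open>W\<close>. As
  \<open>M\<close> is invertible mod \<open>W\<close>, each block has at most \<open>t\<close>
  admissible members. Block \<open>b \<ge> 1\<close> contributes at most \<open>t / (b * W)\<close>,
  and block 0 at most \<open>W\<close> trivially.\<close>

lemma sum_inverse_coprime_le:
  fixes M W N e :: nat
  assumes "coprime M W" "W > 0" "N < 2 ^ e"
  defines "t \<equiv> card {x. x < W \<and> coprime x W}"
  shows "(\<Sum>n | n \<in> {1..N} \<and> coprime (M * n + 1) W. 1 / real n) \<le> real W + real t / real W * real e"
proof -
  define G where "G = {n. n \<in> {1..N} \<and> coprime (M * n + 1) W}"
  define B where "B b = {n \<in> G. n div W = b}" for b
  have fin: "finite G" "finite (B b)" for b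
    by (auto simp: G_def B_def)
  have cardB: "card (B b) \<le> t" for b
    unfolding t_def
  proof (rule card_inj_on_le)
    show "inj_on (\<lambda>n. (M * n + 1) mod W) (B b)"
    proof (rule inj_onI)
      fix n n' assume n: "n \<in> B b" "n' \<in> B b" "(M * n + 1) mod W = (M * n' + 1) mod W"
      then have "[M * n = M * n'] (mod W)"
        by (simp only: cong_def[symmetric] cong_add_rcancel_nat)
      then have "n mod W = n' mod W"
        using assms(1) by (simp add: cong_mult_lcancel_nat cong_def[symmetric])
      moreover have "n div W = n' div W"
        using n by (simp add: B_def)
      ultimately show "n = n'"
        by (metis div_mult_mod_eq)
    qed
    show "(\<lambda>n. (M * n + 1) mod W) ` B b \<subseteq> {x. x < W \<and> coprime x W}"
      using assms(2) by (auto simp: B_def G_def)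
  qed simp
  have "(\<Sum>n\<in>G. 1 / real n) = (\<Sum>b\<in>{0..N}. \<Sum>n\<in>B b. 1 / real n)"
    unfolding B_def using fin
    by (intro sum.group[symmetric]) (auto simp: G_def intro: order_trans[OF div_le_dividend])
  also have "\<dots> = (\<Sum>n\<in>B 0. 1 / real n) + (\<Sum>b = 1..N. \<Sum>n\<in>B b. 1 / real n)"
    by (subst sum.atLeast_Suc_atMost) auto
  also have "(\<Sum>n\<in>B 0. 1 / real n) \<le> real W"
  proof -
    have "(\<Sum>n\<in>B 0. 1 / real n) \<le> real (card (B 0)) * 1"
      by (rule sum_bounded_above) (auto simp: B_def G_def)
    also have "card (B 0) \<le> card {..<W}"
      using assms(2) by (intro card_mono) (auto simp: B_def div_eq_0_iff)
    finally show ?thesis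
      by simp
  qed
  also have "(\<Sum>b = 1..N. \<Sum>n\<in>B b. 1 / real n) \<le> (\<Sum>b = 1..N. real t / real W * (1 / real b))"
  proof (rule sum_mono)
    fix b assume b: "b \<in> {1..N}"
    have "(\<Sum>n\<in>B b. 1 / real n) \<le> real (card (B b)) * (1 / (real b * real W))"
    proof (rule sum_bounded_above)
      fix n assume "n \<in> B b"
      then have "b * W \<le> n"
        by (auto simp: B_def)
      then have "real b * real W \<le> real n"
        by (metis of_nat_le_iff of_nat_mult)
      moreover have "0 < real b * real W"
        using b assms(2) by simp
      ultimately show "1 / real n \<le> 1 / (real b * real W)"
        by (intro divide_left_mono) (auto intro: mult_pos_pos less_le_trans)
    qed
    also have "\<dots> \<le> real t * (1 / (real b * real W))"
      using cardB[of b] by (intro mult_right_mono) auto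
    finally show "(\<Sum>n\<in>B b. 1 / real n) \<le> real t / real W * (1 / real b)"
      by (simp add: mult.commute)
  qed
  also have "\<dots> \<le> real t / real W * real e"
    unfolding sum_distrib_left[symmetric] using sum_inverse_le[OF assms(3)]
    by (intro mult_left_mono) auto
  finally show ?thesis
    by (simp add: G_def)
qed

text \<open>A union bound over \<open>q = M * n + 1\<close>, each having at most
  \<open>N / (M * n)\<close> multiples. Of the primality of \<open>q\<close> only coprimality to
  \<open>W\<close> is kept, which holds because \<open>q > M \<ge> W\<close>.\<close>

lemma card_prime_factor_cong_1_le:
  fixes M W N e :: nat
  assumes "coprime M W" "W > 0" "W \<le> M" "N < 2 ^ e"
  defines "t \<equiv> card {x. x < W \<and> coprime x W}"
  shows "real (card {A \<in> {1..N}. \<exists>q. prime q \<and> q dvd A \<and> [q = 1] (mod M)})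
    \<le> real N / real M * (real W + real t / real W * real e)"
proof -
  define G where "G = {n. n \<in> {1..N} \<and> coprime (M * n + 1) W}"
  define D where "D n = {A \<in> {1..N}. M * n + 1 dvd A}" for n
  have "M > 0"
    using assms(2,3) by simp
  have fin: "finite G"
    by (simp add: G_def)
  have "{A \<in> {1..N}. \<exists>q. prime q \<and> q dvd A \<and> [q = 1] (mod M)} \<subseteq> (\<Union>n\<in>G. D n)"
  proof clarsimp
    fix A q assume A: "Suc 0 \<le> A" "A \<le> N" and q: "prime q" "q dvd A" "[q = Suc 0] (mod M)"
    have "q \<ge> 1" "q > 1"
      using prime_gt_1_nat[OF q(1)] by auto
    then have "M dvd q - 1"
      using q(3) by (simp add: cong_altdef_nat)
    then obtain n where "q - 1 = M * n"
      by (rule dvdE)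
    then have n: "q = M * n + 1"
      using \<open>q \<ge> 1\<close> by simp
    have "n \<noteq> 0"
      using n \<open>q > 1\<close> by (cases n) auto
    have "q > W"
      using n assms(3) \<open>n \<noteq> 0\<close> by (cases n) auto
    then have "\<not> q dvd W"
      using assms(2) dvd_imp_le[of q W] by auto
    then have "coprime q W"
      using q(1) prime_imp_coprime by blast
    moreover have "q \<le> N"
      using A q(2) dvd_imp_le[of q A] by simp
    then have "n \<le> N"
      using n mult_le_mono1[of 1 M n] \<open>M > 0\<close> by linarith
    ultimately have "n \<in> G"
      using n \<open>n \<noteq> 0\<close> unfolding G_def by auto
    then show "\<exists>n\<in>G. A \<in> D n"
      using A q(2) n by (intro bexI[of _ n]) (auto simp: D_def)
  qed
  then have "card {A \<in> {1..N}. \<exists>q. prime q \<and> q dvd A \<and> [q = 1] (mod M)} \<le> card (\<Union>n\<in>G. D n)"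
    using fin by (intro card_mono) (auto simp: D_def)
  also have "\<dots> \<le> (\<Sum>n\<in>G. card (D n))"
    by (rule card_UN_le[OF fin])
  finally have "real (card {A \<in> {1..N}. \<exists>q. prime q \<and> q dvd A \<and> [q = 1] (mod M)}) \<le> real (\<Sum>n\<in>G. card (D n))"
    by (simp only: of_nat_le_iff)
  also have "\<dots> = (\<Sum>n\<in>G. real (card (D n)))"
    by simp
  also have "\<dots> \<le> (\<Sum>n\<in>G. real N / real M * (1 / real n))"
  proof (rule sum_mono)
    fix n assume "n \<in> G"
    then have "n > 0"
      by (simp add: G_def)
    have "D n \<subseteq> (\<lambda>c. (M * n + 1) * c) ` {1..N div (M * n + 1)}"
    proof
      fix A assume "A \<in> D n"
      then obtain c where c: "A = (M * n + 1) * c" "1 \<le> A" "A \<le> N"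
        unfolding D_def by auto
      have "c * (M * n + 1) \<le> N"
        using c by (simp add: mult.commute)
      then have "c \<le> N div (M * n + 1)"
        by (simp add: less_eq_div_iff_mult_less_eq)
      moreover have "c \<ge> 1"
        using c(1,2) by (cases c) auto
      ultimately show "A \<in> (\<lambda>c. (M * n + 1) * c) ` {1..N div (M * n + 1)}"
        using c(1) by auto
    qed
    then have "card (D n) \<le> N div (M * n + 1)"
      using surj_card_le[of "{1..N div (M * n + 1)}"] by simp
    then have "real (card (D n)) \<le> real N / real (M * n + 1)"
      using real_of_int_div4[of "int N" "int (M * n + 1)"] zdiv_int[of N "M * n + 1"] by simp
    also have "\<dots> \<le> real N / real (M * n)"
      using \<open>M > 0\<close> \<open>n > 0\<close> by (intro frac_le) auto
    finally show "real (card (D n)) \<le> real N / real M * (1 / real n)"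
      by simp
  qed
  also have "\<dots> = real N / real M * (\<Sum>n\<in>G. 1 / real n)"
    by (simp add: sum_distrib_left)
  also have "\<dots> \<le> real N / real M * (real W + real t / real W * real e)"
    using sum_inverse_coprime_le[OF assms(1,2,4)] by (intro mult_left_mono) (auto simp: G_def t_def)
  finally show ?thesis .
qed

section \<open>Density\<close>

lemma ex_double_power_2_interval:
  fixes N :: nat
  assumes "2 ^ 2 ^ i0 \<le> N"
  obtains i where "i \<ge> i0" "2 ^ 2 ^ i \<le> N" "N < 2 ^ 2 ^ Suc i"
proof -
  have bound: "i \<le> N" if "2 ^ 2 ^ i \<le> N" for i
    using that less_exp[of i] less_exp[of "2 ^ i"] by linarith
  define i where "i = (GREATEST i. 2 ^ 2 ^ i \<le> N)"
  have "2 ^ 2 ^ i \<le> N"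
    unfolding i_def using assms bound by (rule GreatestI_nat)
  moreover have max: "j \<le> i" if "2 ^ 2 ^ j \<le> N" for j
    unfolding i_def using that bound by (rule Greatest_le_nat)
  have "i0 \<le> i"
    by (rule max[OF assms])
  moreover have "\<not> 2 ^ 2 ^ Suc i \<le> N"
    using max[of "Suc i"] not_less_eq_eq[of i i] by blast
  ultimately show ?thesis
    using that not_le by blast
qed

lemma eventually_card_not_order_dominant_le:
  "\<exists>N0. \<forall>N\<ge>N0. real (card ({A. A > 0 \<and> \<not> order_dominant (of_nat A) 2} \<inter> {1..N})) \<le> real N * (4 / 2 ^ J)"
proof -
  obtain W where W: "odd W" "4 ^ J * card {x. x < W \<and> coprime x W} \<le> W"
    using ex_small_coprime_density by blast
  define t where "t = card {x. x < W \<and> coprime x W}"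
  have W0: "W > 0"
    using W(1) by (cases W) auto
  have "real (4 ^ J * t) \<le> real W"
    using W(2) unfolding t_def by (simp only: of_nat_le_iff)
  then have tW: "real t / real W * 4 ^ J \<le> 1"
    using W0 by (simp add: field_simps)
  \<comment> \<open>The summand \<open>W * 2 ^ J\<close> makes \<open>W / M\<close> at most
    \<open>1 / 2 ^ J\<close>; the 2 secures \<open>k \<ge> 2\<close>.\<close>
  define k0 where "k0 = W * 2 ^ J + 2"
  show ?thesis
  proof (intro exI[of _ "2 ^ 2 ^ (k0 + J)"] allI impI)
    fix N :: nat assume "2 ^ 2 ^ (k0 + J) \<le> N"
    then obtain i where i: "i \<ge> k0 + J" "2 ^ 2 ^ i \<le> N" "N < 2 ^ 2 ^ Suc i"
      by (rule ex_double_power_2_interval)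
    \<comment> \<open>The \<open>J\<close> Fermat numbers of index \<open>k\<close> to
      \<open>i - 1\<close> are the largest ones whose product is still controlled by
      \<open>2 ^ 2 ^ i \<le> N\<close>.\<close>
    define k where "k = i - J"
    have k: "k \<ge> k0" "k \<ge> 2" "i = k + J"
      using i(1) by (auto simp: k_def k0_def)
    define M :: nat where "M = 2 ^ Suc k"
    have "W * 2 ^ J \<le> k"
      using k(1) by (simp add: k0_def)
    also have "k < M"
      using less_exp[of "Suc k"] by (simp add: M_def)
    finally have WM: "W * 2 ^ J < M" .
    then have "W \<le> M"
      using mult_le_mono2[of 1 "2 ^ J" W] one_le_power[of "2::nat" J] by linarith
    have "M > 0"
      by (simp add: M_def)
    define E where "E = {A \<in> {1..N}. \<exists>q. prime q \<and> q dvd A \<and> [q = 1] (mod M)}"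
    define B where "B = {A \<in> {1..N}. \<forall>j<J. jacobi (int A) (fermat (k + j)) = 1}"
    have "{A. A > 0 \<and> \<not> order_dominant (of_nat A) 2} \<inter> {1..N} \<subseteq> B \<union> E"
    proof
      fix A assume "A \<in> {A. A > 0 \<and> \<not> order_dominant (of_nat A) 2} \<inter> {1..N}"
      then show "A \<in> B \<union> E"
        using not_order_dominant_cases[of A k] k(2) by (auto simp: B_def E_def M_def)
    qed
    then have "card ({A. A > 0 \<and> \<not> order_dominant (of_nat A) 2} \<inter> {1..N}) \<le> card (B \<union> E)"
      by (intro card_mono) (auto simp: B_def E_def)
    then have le: "real (card ({A. A > 0 \<and> \<not> order_dominant (of_nat A) 2} \<inter> {1..N})) \<le> real (card B) + real (card E)"
      using card_Un_le[of B E] by linarith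
    have "2 ^ J * card B \<le> 2 * N"
      unfolding B_def using i(2) k by (intro card_jacobi_fermat_le) auto
    then have "real (2 ^ J * card B) \<le> real (2 * N)"
      by (simp only: of_nat_le_iff)
    then have B: "real (card B) \<le> real N * (2 / 2 ^ J)"
      by (simp add: field_simps)
    have "real (card E) \<le> real N / real M * (real W + real t / real W * real (2 ^ Suc i))"
      unfolding E_def t_def using W0 \<open>W \<le> M\<close> i(3) W(1)
      by (intro card_prime_factor_cong_1_le) (auto simp: M_def)
    \<comment> \<open>The harmonic sum costs a factor \<open>2 ^ J\<close> relative to
      \<open>M\<close>; the choice of \<open>W\<close> with \<open>t / W \<le> 1 / 4 ^ J\<close>
      absorbs it and leaves \<open>1 / 2 ^ J\<close>.\<close>
    also have "real (2 ^ Suc i) = real M * 2 ^ J"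
      by (simp add: M_def k(3) power_add)
    also have "real N / real M * (real W + real t / real W * (real M * 2 ^ J))
        = real N * (real W / real M + real t / real W * 2 ^ J)"
      using \<open>M > 0\<close> by (simp add: distrib_left)
    also have "\<dots> \<le> real N * (1 / 2 ^ J + 1 / 2 ^ J)"
    proof (intro mult_left_mono add_mono)
      have "real (W * 2 ^ J) \<le> real M"
        using WM by (simp only: of_nat_le_iff)
      then show "real W / real M \<le> 1 / 2 ^ J"
        using \<open>M > 0\<close> by (simp add: field_simps)
      have "real t / real W * 2 ^ J * 2 ^ J \<le> 1"
        using tW by (simp add: mult.assoc power_mult_distrib[symmetric])
      then show "real t / real W * 2 ^ J \<le> 1 / 2 ^ J"
        by (simp add: field_simps)
    qed simp
    finally have "real (card E) \<le> real N * (1 / 2 ^ J + 1 / 2 ^ J)" .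
    with le B have "real (card ({A. A > 0 \<and> \<not> order_dominant (of_nat A) 2} \<inter> {1..N}))
        \<le> real N * (2 / 2 ^ J) + real N * (1 / 2 ^ J + 1 / 2 ^ J)"
      by linarith
    also have "\<dots> = real N * (4 / 2 ^ J)"
      by (simp add: field_simps)
    finally show "real (card ({A. A > 0 \<and> \<not> order_dominant (of_nat A) 2} \<inter> {1..N})) \<le> real N * (4 / 2 ^ J)" .
  qed
qed

theorem theorem1p2:
  shows "has_asymptotic_density
           {A :: nat. A > 0 \<and> (A = 1 \<or> \<not> order_dominant (of_nat A) 2)} 0"
proof -
  define S where "S = {A :: nat. A > 0 \<and> \<not> order_dominant (of_nat A) 2}"
  \<comment> \<open>\<open>order_dominant\<close> excludes the value 1, so the number 1 lies in
    \<open>S\<close>.\<close>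
  have S: "{A :: nat. A > 0 \<and> (A = 1 \<or> \<not> order_dominant (of_nat A) 2)} = S"
    by (auto simp: S_def order_dominant_def)
  show ?thesis
    unfolding S has_asymptotic_density_def
  proof (rule LIMSEQ_I)
    fix r :: real assume "0 < r"
    then obtain J where "(1 / 2) ^ J < r / 4"
      using real_arch_pow_inv[of "r / 4" "1 / 2"] by auto
    then have J: "4 / 2 ^ J < r"
      by (simp add: power_one_over)
    obtain N0 where N0: "\<And>N. N \<ge> N0 \<Longrightarrow> real (card (S \<inter> {1..N})) \<le> real N * (4 / 2 ^ J)"
      using eventually_card_not_order_dominant_le[of J] unfolding S_def by blast
    \<comment> \<open>Starting at \<open>N0 + 1\<close> keeps \<open>N\<close> positive, so that the
      bound can be divided by it.\<close>
    have "norm (real (card (S \<inter> {1..N})) / real N - 0) < r" if "N \<ge> N0 + 1" for N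
    proof -
      have "real (card (S \<inter> {1..N})) / real N \<le> 4 / 2 ^ J"
        using N0[of N] that by (simp add: field_simps)
      with J show ?thesis
        by simp
    qed
    then show "\<exists>N0. \<forall>N\<ge>N0. norm (real (card (S \<inter> {1..N})) / real N - 0) < r"
      by blast
  qed
qed

end
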